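(* For every positive integer $n$, $$R_7(n)=8\sigma(n)-32\sigma\left(\tfrac{n}{4}\right)+8\sigma\left(\tfrac{n}{7}\right)-32\sigma\left(\tfrac{n}{28}\right)+64\,W_{1,7}(n)+1024\,W_{1,7}\left(\tfrac{n}{4}\right)-256\left(W_{4,7}(n)+W_{1,28}(n)\right).$$
   Context: For $n\in\mathbb{N}=\{1,2,3,\dots\}$, $\sigma(n)=\sum_{d\mid n}d$ (sum over positive divisors), and $\sigma(x)=0$ if $x\notin\mathbb{N}$. For $a,b\in\mathbb{N}$ with $a\le b$, the convolution sum is $$W_{a,b}(n)=\sum_{(l,m)\in\mathbb{N}^2,\ al+bm=n}\sigma(l)\sigma(m),$$ and $W_{a,b}(x)=0$ if $x\notin\mathbb{N}$ (the defining sum is then empty). For $n\in\mathbb{N}$, $R_7(n)$ is the number of $(x_1,\dots,x_8)\in\mathbb{Z}^8$ with $$n=x_1^2+x_2^2+x_3^2+x_4^2+7(x_5^2+x_6^2+x_7^2+x_8^2).$$ *)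

theory Defs
  imports Complex_Main
begin

text \<open>
  Both \<open>sigma\<close> and \<open>W\<close> are taken on all rationals, so that \<open>sigma (n / 4)\<close> means the value at
  the exact quotient, which is 0 unless the quotient is a positive integer. The values are
  integers because the formula has subtractions.
\<close>

definition sigma :: "rat \<Rightarrow> int" where
  "sigma x = (if x \<in> \<nat> - {0} then (\<Sum>d | d dvd nat \<lfloor>x\<rfloor>. int d) else 0)"

lemma sigma_of_nat: "n > 0 \<Longrightarrow> sigma (of_nat n) = (\<Sum>d | d dvd n. int d)"
  by (simp add: sigma_def)

lemma sigma_eq_0: "(\<And>n::nat. n > 0 \<Longrightarrow> x \<noteq> of_nat n) \<Longrightarrow> sigma x = 0"
  by (metis sigma_def DiffD1 DiffD2 Nats_cases gr0I insertI1 of_nat_0)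

text \<open>
  Only meaningful for positive \<open>a\<close> and \<open>b\<close>, where the index set is finite; it is empty when \<open>x\<close> is
  not a positive integer.
\<close>

definition W :: "nat \<Rightarrow> nat \<Rightarrow> rat \<Rightarrow> int" where
  "W a b x = (\<Sum>(l, m) \<in> {(l, m). l > 0 \<and> m > 0 \<and> of_nat (a * l + b * m) = x}.
     sigma (of_nat l) * sigma (of_nat m))"

definition R7 :: "nat \<Rightarrow> nat" where
  "R7 n = card {(x1, x2, x3, x4, x5, x6, x7, x8).
     int n = x1\<^sup>2 + x2\<^sup>2 + x3\<^sup>2 + x4\<^sup>2 + 7 * (x5\<^sup>2 + x6\<^sup>2 + x7\<^sup>2 + x8\<^sup>2)}"

end

theory Submission
  imports Defs
begin

text \<open>
  The number \<open>r\<close> of representations by four squares satisfies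
  \<open>\<Sum>x. (n - 5 * x\<^sup>2) * r (n - x\<^sup>2) = 0\<close> for \<open>n > 0\<close>, because the five coordinates of a
  representation of \<open>n\<close> by five squares contribute equally on average. This recurrence and
  \<open>r 0 = 1\<close> determine \<open>r\<close>. That \<open>8 * \<sigma> n - 32 * \<sigma> (n / 4)\<close> satisfies it too is a Liouville
  identity on the triples with \<open>x\<^sup>2 + d * e = n\<close>, proved by two involutions of Zagier's type;
  this gives Jacobi's four-square theorem. The formula for \<open>R7\<close> then comes from multiplying out
  \<open>\<Sum>k + 7 * l = n. r k * r l\<close>.
\<close>

subsection \<open>A Liouville identity\<close>

text \<open>The weight turns \<open>\<sigma> m\<close> into \<open>\<sigma> m - 4 * \<sigma> (m / 4)\<close>, using the parities of both divisors only.\<close>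

definition parity_weight :: "int \<Rightarrow> int \<Rightarrow> int" where
  "parity_weight d e = (if even d \<and> even e then -1 else 1)"

definition divisor_triples :: "int \<Rightarrow> (int \<times> int \<times> int) set" where
  "divisor_triples n = {(x, d, e). d > 0 \<and> e > 0 \<and> x\<^sup>2 + d * e = n}"

definition divisor_pairs :: "int \<Rightarrow> (int \<times> int) set" where
  "divisor_pairs m = {(d, e). d > 0 \<and> e > 0 \<and> d * e = m}"

text \<open>Two substitutions permute the three linear factors up to sign: (x, d, e) -> (-x-d, d,
  e-2x-d) exchanges the first two and negates the third, while (x, d, e) -> (-x, e, d) exchanges the
  last two.\<close>

definition liouville_fun :: "int \<times> int \<times> int \<Rightarrow> int" where
  "liouville_fun = (\<lambda>(x, d, e). parity_weight d e * ((d + e) * (e - 2 * x) * (d + 2 * x)))"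

lemma abs_le_of_square_le:
  fixes x n :: int
  assumes "x\<^sup>2 \<le> n"
  shows "-n \<le> x" "x \<le> n"
proof -
  have "\<bar>x\<bar> \<le> \<bar>x\<bar> * \<bar>x\<bar>" 
    by (cases "x = 0") (auto intro: mult_right_mono[of 1 "\<bar>x\<bar>" "\<bar>x\<bar>", simplified])
  also have "\<dots> \<le> n" using assms by (simp add: power2_eq_square)
  finally show "-n \<le> x" "x \<le> n" by auto
qed

lemma divisor_pair_bounds:
  fixes d e m :: int
  assumes "d > 0" "e > 0" "d * e \<le> m"
  shows "d \<le> m" "e \<le> m"
proof -
  have "d * 1 \<le> d * e" "1 * e \<le> d * e" using assms by (intro mult_mono; simp)+
  then show "d \<le> m" "e \<le> m" using assms(3) by auto
qed

lemma finite_divisor_pairs: "finite (divisor_pairs m)"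
proof (rule finite_subset)
  show "divisor_pairs m \<subseteq> {0..m} \<times> {0..m}"
  proof
    fix p assume "p \<in> divisor_pairs m"
    then obtain d e where p: "p = (d, e)" "d > 0" "e > 0" "d * e = m" by (auto simp: divisor_pairs_def)
    then show "p \<in> {0..m} \<times> {0..m}" using divisor_pair_bounds[of d e m] by simp
  qed
qed simp

lemma divisor_triples_Sigma: "divisor_triples n = (SIGMA x:{-n..n}. divisor_pairs (n - x\<^sup>2))"
proof -
  have "-n \<le> x \<and> x \<le> n" if "d > 0" "e > 0" "x\<^sup>2 + d * e = n" for x d e :: int
  proof -
    have "d * e > 0" using that by simp
    then show ?thesis using abs_le_of_square_le[of x n] that by linarith
  qed
  then show ?thesis
    by (auto simp: divisor_triples_def divisor_pairs_def algebra_simps)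
qed

lemma finite_divisor_triples: "finite (divisor_triples n)"
  by (simp add: divisor_triples_Sigma finite_divisor_pairs)

text \<open>Evaluates what survives the cancellation in \<open>sum_liouville_fun\<close>.\<close>

lemma alternating_sum_mult_complement:
  "(\<Sum>d\<in>{0<..<2 * int k}. parity_weight d d * (d * (2 * int k - d))) = int k"
proof -
  \<comment> \<open>The induction adds an even and an odd term at a time, with \<open>c\<close> kept
    independent of the number of terms; the case needed is \<open>c = 2 * int k\<close>,
    \<open>m = k\<close>.\<close>
  have gen: "(\<Sum>d<2 * m. parity_weight (int d) (int d) * (int d * (c - int d)))
     = c * int m - int m * (2 * int m - 1)" for m c
    by (induction m) (auto simp: parity_weight_def algebra_simps)
  have "(\<Sum>d\<in>{0<..<2 * int k}. parity_weight d d * (d * (2 * int k - d)))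
      = (\<Sum>d\<in>int ` {..<2 * k}. parity_weight d d * (d * (2 * int k - d)))"
  proof (rule sum.mono_neutral_left)
    show "{0<..<2 * int k} \<subseteq> int ` {..<2 * k}"
    proof
      fix d assume "d \<in> {0<..<2 * int k}"
      then have "d = int (nat d)" "nat d < 2 * k" by auto
      then show "d \<in> int ` {..<2 * k}" by blast
    qed
  qed auto
  also have "\<dots> = (\<Sum>d<2 * k. parity_weight (int d) (int d) * (int d * (2 * int k - int d)))"
    by (subst sum.reindex) (auto simp: o_def)
  also have "\<dots> = int k"
    unfolding gen by (simp add: algebra_simps)
  finally show ?thesis .
qed

lemma sum_liouville_fun:
  assumes "n > 0"
  shows "(\<Sum>t\<in>divisor_triples n. liouville_fun t) = (if \<exists>k. n = k\<^sup>2 then 2 * n else 0)"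
proof -
  let ?S = "divisor_triples n"
  define A where "A = {(x, d, e) \<in> ?S. e - 2 * x - d > 0}"
  define B where "B = {(x, d, e) \<in> ?S. e - 2 * x - d < 0}"
  define C where "C = {(x, d, e) \<in> ?S. e - 2 * x - d = 0}"
  have fin: "finite A" "finite B" "finite C"
    by (auto simp: A_def B_def C_def intro: finite_subset[OF _ finite_divisor_triples])
  \<comment> \<open>\<open>J\<close> preserves x^2 + d*e and exchanges e with e - 2x - d, so it is
    an involution exactly where the latter is positive.\<close>
  define J where "J = (\<lambda>(x, d, e). (- x - d, d, e - 2 * x - d :: int))"
  have JA: "J t \<in> A" "J (J t) = t" "liouville_fun (J t) = - liouville_fun t" if "t \<in> A" for t
  proof -
    obtain x d e where t: "t = (x, d, e)" by (cases t)
    show "J t \<in> A"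
      using that unfolding t by (simp add: A_def J_def divisor_triples_def power2_eq_square algebra_simps)
    show "J (J t) = t"
      unfolding t by (simp add: J_def)
    \<comment> \<open>Modulo 2 the new third entry is e - d, so d and it are both even iff d and e
      are.\<close>
    have "parity_weight d (e - 2 * x - d) = parity_weight d e"
      by (auto simp: parity_weight_def)
    then show "liouville_fun (J t) = - liouville_fun t"
      unfolding t by (simp add: J_def liouville_fun_def algebra_simps)
  qed
  have "(\<Sum>t\<in>A. liouville_fun t) = (\<Sum>t\<in>A. - liouville_fun t)"
    by (rule sum.reindex_bij_witness[where i = J and j = J]) (use JA in auto)
  then have A0: "(\<Sum>t\<in>A. liouville_fun t) = 0"
    by (simp add: sum_negf)
  \<comment> \<open>The second substitution negates e - 2x - d and fixes
    \<open>liouville_fun\<close>, so it carries \<open>B\<close> onto \<open>A\<close>.\<close>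
  have "(\<Sum>t\<in>B. liouville_fun t) = (\<Sum>t\<in>A. liouville_fun t)"
    by (rule sum.reindex_bij_witness[where i = "\<lambda>(x, d, e). (- x, e, d)" and j = "\<lambda>(x, d, e). (- x, e, d)"])
      (auto simp: A_def B_def divisor_triples_def liouville_fun_def parity_weight_def
        power2_eq_square algebra_simps)
  then have B0: "(\<Sum>t\<in>B. liouville_fun t) = 0" using A0 by simp
  have "(\<Sum>t\<in>?S. liouville_fun t) = (\<Sum>t\<in>A \<union> (B \<union> C). liouville_fun t)"
    by (rule sum.cong) (auto simp: A_def B_def C_def)
  also have "\<dots> = (\<Sum>t\<in>C. liouville_fun t)"
    using fin A0 B0 by (subst sum.union_disjoint; (subst sum.union_disjoint)?) (auto simp: A_def B_def C_def)
  also have "\<dots> = (if \<exists>k. n = k\<^sup>2 then 2 * n else 0)"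
  proof (cases "\<exists>k. n = k\<^sup>2")
    case False
    \<comment> \<open>With e = 2x + d, the equation x^2 + d*e = n becomes a perfect square.\<close>
    have "n = (x + d)\<^sup>2" if "(x, d, e) \<in> C" for x d e
      using that by (auto simp: C_def divisor_triples_def power2_eq_square algebra_simps)
    then have "C = {}" using False by auto
    then show ?thesis using False by simp
  next
    case True
    then obtain k0 where "n = k0\<^sup>2" by blast
    then obtain k :: nat where k: "n = (int k)\<^sup>2" by (metis power2_abs zero_le_imp_eq_int abs_ge_zero)
    \<comment> \<open>Here d determines the triple: x = k - d and e = 2k - d. The factors of
      \<open>liouville_fun\<close> become 2k, d and 2k - d.\<close>
    have "(\<Sum>t\<in>C. liouville_fun t)
        = (\<Sum>d\<in>{0<..<2 * int k}. 2 * int k * (parity_weight d d * (d * (2 * int k - d))))"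
    proof (rule sum.reindex_bij_witness[where j = "\<lambda>(x, d, e). d"
          and i = "\<lambda>d. (int k - d, d, 2 * int k - d)"])
      fix t assume "t \<in> C"
      obtain x d e where "t = (x, d, e)" by (cases t)
      with \<open>t \<in> C\<close> have t: "t = (x, d, e)" "d > 0" "e > 0" "e = 2 * x + d" "x\<^sup>2 + d * e = n"
        by (auto simp: C_def divisor_triples_def)
      then have "(x + d)\<^sup>2 = (int k)\<^sup>2" using k by (simp add: power2_eq_square algebra_simps)
      \<comment> \<open>2(x + d) = d + e, which selects the positive square root.\<close>
      moreover have "x + d > 0" using t by linarith
      ultimately have "x + d = int k" by (simp add: power2_eq_iff)
      then have x: "x = int k - d" "e = 2 * int k - d" using t by auto
      show "(case t of (x, d, e) \<Rightarrow> d) \<in> {0<..<2 * int k}"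
        "(int k - (case t of (x, d, e) \<Rightarrow> d), case t of (x, d, e) \<Rightarrow> d,
          2 * int k - (case t of (x, d, e) \<Rightarrow> d)) = t"
        using t x by auto
      show "2 * int k * (parity_weight (case t of (x, d, e) \<Rightarrow> d) (case t of (x, d, e) \<Rightarrow> d)
          * ((case t of (x, d, e) \<Rightarrow> d) * (2 * int k - (case t of (x, d, e) \<Rightarrow> d)))) = liouville_fun t"
        unfolding t(1) x by (auto simp: liouville_fun_def parity_weight_def algebra_simps)
    qed (auto simp: C_def divisor_triples_def k power2_eq_square algebra_simps)
    also have "\<dots> = 2 * int k * int k"
      by (simp only: sum_distrib_left[symmetric] alternating_sum_mult_complement)
    finally show ?thesis using True k by (simp add: power2_eq_square)
  qed
  finally show ?thesis .
qed

text \<open>Averaging over \<open>x \<mapsto> - x\<close> and \<open>d \<leftrightarrow> e\<close> removes the part of \<open>liouville_fun\<close> that is odd in \<open>x\<close>.\<close>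

lemma liouville_identity:
  assumes "n > 0"
  shows "(\<Sum>(x, d, e)\<in>divisor_triples n. (n - 5 * x\<^sup>2) * (parity_weight d e * d))
    = (if \<exists>k. n = k\<^sup>2 then n else 0)"
proof -
  let ?S = "divisor_triples n"
  let ?g = "\<lambda>(x, d, e). (n - 5 * x\<^sup>2) * (parity_weight d e * d)"
  have neg: "(\<Sum>t\<in>?S. liouville_fun t) = (\<Sum>(x, d, e)\<in>?S. liouville_fun (- x, d, e))"
    by (rule sum.reindex_bij_witness[where i = "\<lambda>(x, d, e). (- x, d, e)" and j = "\<lambda>(x, d, e). (- x, d, e)"])
      (auto simp: divisor_triples_def)
  have swap: "(\<Sum>t\<in>?S. ?g t) = (\<Sum>(x, d, e)\<in>?S. ?g (x, e, d))"
    by (rule sum.reindex_bij_witness[where i = "\<lambda>(x, d, e). (x, e, d)" and j = "\<lambda>(x, d, e). (x, e, d)"])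
      (auto simp: divisor_triples_def mult.commute)
  have "2 * (\<Sum>t\<in>?S. liouville_fun t) 
      = (\<Sum>(x, d, e)\<in>?S. liouville_fun (x, d, e) + liouville_fun (- x, d, e))"
    using neg by (simp add: sum.distrib case_prod_unfold)
  \<comment> \<open>The part of \<open>liouville_fun\<close> even in x is (d + e)(d*e - 4x^2) times
    the weight, and d*e - 4x^2 = n - 5x^2 on the triples.\<close>
  also have "\<dots> = (\<Sum>(x, d, e)\<in>?S. 2 * (?g (x, d, e) + ?g (x, e, d)))"
  proof (rule sum.cong; clarify?)
    fix x d e assume "(x, d, e) \<in> ?S"
    then have n: "n = x\<^sup>2 + d * e" by (simp add: divisor_triples_def)
    show "liouville_fun (x, d, e) + liouville_fun (- x, d, e)
        = 2 * ((n - 5 * x\<^sup>2) * (parity_weight d e * d) + (n - 5 * x\<^sup>2) * (parity_weight e d * e))"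
      unfolding n by (auto simp: liouville_fun_def parity_weight_def power2_eq_square algebra_simps)
  qed
  also have "\<dots> = 4 * (\<Sum>t\<in>?S. ?g t)"
    using swap by (simp add: sum.distrib sum_distrib_left[symmetric] case_prod_unfold)
  finally show ?thesis using sum_liouville_fun[OF assms] by (auto split: if_splits)
qed

subsection \<open>Jacobi's four-square theorem\<close>

text \<open>An integer argument lets n - x^2 become negative, where the set is empty; the
  recurrences can then run over all x in \<open>{-n..n}\<close>.\<close>

definition four_squares :: "int \<Rightarrow> (int \<times> int \<times> int \<times> int) set" where
  "four_squares m = {(a, b, c, d). a\<^sup>2 + b\<^sup>2 + c\<^sup>2 + d\<^sup>2 = m}"

lemma four_squares_neg: "m < 0 \<Longrightarrow> four_squares m = {}"
  by (auto simp: four_squares_def) (smt (verit) zero_le_power2)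

lemma four_squares_0: "four_squares 0 = {(0, 0, 0, 0)}"
  by (auto simp: four_squares_def) (smt (verit) zero_le_power2 power2_eq_square zero_eq_power2)+

lemma finite_four_squares: "finite (four_squares m)"
proof (rule finite_subset)
  have "-m \<le> x \<and> x \<le> m" if "x\<^sup>2 \<le> m" for x using abs_le_of_square_le[OF that] by simp
  moreover have "a\<^sup>2 \<le> m" "b\<^sup>2 \<le> m" "c\<^sup>2 \<le> m" "d\<^sup>2 \<le> m" if "a\<^sup>2 + b\<^sup>2 + c\<^sup>2 + d\<^sup>2 = m" for a b c d
    using that zero_le_power2[of a] zero_le_power2[of b] zero_le_power2[of c] zero_le_power2[of d]
    by linarith+
  ultimately show "four_squares m \<subseteq> {-m..m} \<times> {-m..m} \<times> {-m..m} \<times> {-m..m}"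
    unfolding four_squares_def by (clarsimp; blast)
qed simp

lemma four_squares_recurrence:
  "(\<Sum>x\<in>{-n..n}. (n - 5 * x\<^sup>2) * int (card (four_squares (n - x\<^sup>2)))) = 0"
proof -
  define P where "P = (SIGMA x:{-n..n}. four_squares (n - x\<^sup>2))"
  have P: "P = {(x, a, b, c, d). x\<^sup>2 + a\<^sup>2 + b\<^sup>2 + c\<^sup>2 + d\<^sup>2 = n}"
  proof -
    have "-n \<le> x \<and> x \<le> n" if "x\<^sup>2 + a\<^sup>2 + b\<^sup>2 + c\<^sup>2 + d\<^sup>2 = n" for x a b c d
      using abs_le_of_square_le[of x n] that
        zero_le_power2[of a] zero_le_power2[of b] zero_le_power2[of c] zero_le_power2[of d] by linarith
    then show ?thesis by (auto simp: P_def four_squares_def algebra_simps)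
  qed
  let ?s = "\<Sum>(x, a, b, c, d)\<in>P. x\<^sup>2"
  have a: "(\<Sum>(x, a, b, c, d)\<in>P. a\<^sup>2) = ?s"
    by (rule sum.reindex_bij_witness[where i = "\<lambda>(x, a, b, c, d). (a, x, b, c, d)"
          and j = "\<lambda>(x, a, b, c, d). (a, x, b, c, d)"]) (auto simp: P)
  have b: "(\<Sum>(x, a, b, c, d)\<in>P. b\<^sup>2) = ?s"
    by (rule sum.reindex_bij_witness[where i = "\<lambda>(x, a, b, c, d). (b, a, x, c, d)"
          and j = "\<lambda>(x, a, b, c, d). (b, a, x, c, d)"]) (auto simp: P)
  have c: "(\<Sum>(x, a, b, c, d)\<in>P. c\<^sup>2) = ?s"
    by (rule sum.reindex_bij_witness[where i = "\<lambda>(x, a, b, c, d). (c, a, b, x, d)"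
          and j = "\<lambda>(x, a, b, c, d). (c, a, b, x, d)"]) (auto simp: P)
  have d: "(\<Sum>(x, a, b, c, d)\<in>P. d\<^sup>2) = ?s"
    by (rule sum.reindex_bij_witness[where i = "\<lambda>(x, a, b, c, d). (d, a, b, c, x)"
          and j = "\<lambda>(x, a, b, c, d). (d, a, b, c, x)"]) (auto simp: P)
  have "(\<Sum>x\<in>{-n..n}. (n - 5 * x\<^sup>2) * int (card (four_squares (n - x\<^sup>2))))
      = (\<Sum>x\<in>{-n..n}. \<Sum>q\<in>four_squares (n - x\<^sup>2). n - 5 * x\<^sup>2)"
    by (simp add: mult.commute)
  also have "\<dots> = (\<Sum>(x, q)\<in>P. n - 5 * x\<^sup>2)"
    unfolding P_def by (rule sum.Sigma) (auto simp: finite_four_squares)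
  \<comment> \<open>Writing n as the sum of five squares leaves five equal sums, one per coordinate,
    against 5 times the first.\<close>
  also have "\<dots> = (\<Sum>(x, a, b, c, d)\<in>P. (x\<^sup>2 + a\<^sup>2 + b\<^sup>2 + c\<^sup>2 + d\<^sup>2) - 5 * x\<^sup>2)"
    by (rule sum.cong) (auto simp: P)
  also have "\<dots> = (\<Sum>(x, a, b, c, d)\<in>P. x\<^sup>2) + (\<Sum>(x, a, b, c, d)\<in>P. a\<^sup>2) + (\<Sum>(x, a, b, c, d)\<in>P. b\<^sup>2)
      + (\<Sum>(x, a, b, c, d)\<in>P. c\<^sup>2) + (\<Sum>(x, a, b, c, d)\<in>P. d\<^sup>2) - 5 * ?s"
    by (simp only: sum.distrib sum_subtractf sum_distrib_left case_prod_unfold)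
  also have "\<dots> = 0" unfolding a b c d by simp
  finally show ?thesis .
qed

section \<open>The same recurrence for the divisor sum\<close>

definition weighted_divisor_sum :: "int \<Rightarrow> int" where
  "weighted_divisor_sum m = (\<Sum>(d, e)\<in>divisor_pairs m. parity_weight d e * d)"

lemma divisor_pairs_nonpos: "m \<le> 0 \<Longrightarrow> divisor_pairs m = {}"
  by (auto simp: divisor_pairs_def) (smt (verit) mult_pos_pos)

text \<open>The factor 8 is forced here: for square n the two roots of x^2 = n contribute 2(n - 5n)
  = -8n, and \<open>liouville_identity\<close> contributes 8 times n. For other n both parts
  vanish.\<close>

lemma weighted_divisor_sum_recurrence:
  assumes "n > 0"
  shows "(\<Sum>x\<in>{-n..n}. (n - 5 * x\<^sup>2) * (of_bool (x\<^sup>2 = n) + 8 * weighted_divisor_sum (n - x\<^sup>2))) = 0"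
proof -
  have "(\<Sum>x\<in>{-n..n}. (n - 5 * x\<^sup>2) * weighted_divisor_sum (n - x\<^sup>2))
      = (\<Sum>x\<in>{-n..n}. \<Sum>p\<in>divisor_pairs (n - x\<^sup>2). (n - 5 * x\<^sup>2) * (parity_weight (fst p) (snd p) * fst p))"
    by (simp add: weighted_divisor_sum_def sum_distrib_left case_prod_unfold)
  also have "\<dots> = (\<Sum>(x, d, e)\<in>divisor_triples n. (n - 5 * x\<^sup>2) * (parity_weight d e * d))"
    unfolding divisor_triples_Sigma
    by (subst sum.Sigma) (auto simp: finite_divisor_pairs case_prod_unfold)
  also have "\<dots> = (if \<exists>k. n = k\<^sup>2 then n else 0)"
    by (rule liouville_identity[OF assms])
  finally have 1: "(\<Sum>x\<in>{-n..n}. (n - 5 * x\<^sup>2) * weighted_divisor_sum (n - x\<^sup>2))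
    = (if \<exists>k. n = k\<^sup>2 then n else 0)" .
  have 2: "(\<Sum>x\<in>{-n..n}. (n - 5 * x\<^sup>2) * of_bool (x\<^sup>2 = n)) = (if \<exists>k. n = k\<^sup>2 then - 8 * n else 0)"
  proof (cases "\<exists>k. n = k\<^sup>2")
    case True
    then obtain k where k: "n = k\<^sup>2" by blast
    with assms have "k \<noteq> 0" by auto
    have "(\<Sum>x\<in>{-n..n}. (n - 5 * x\<^sup>2) * of_bool (x\<^sup>2 = n)) = (\<Sum>x\<in>{k, -k}. (n - 5 * x\<^sup>2) * of_bool (x\<^sup>2 = n))"
      using abs_le_of_square_le[of k n] abs_le_of_square_le[of "-k" n] k
      by (intro sum.mono_neutral_right) (auto simp: power2_eq_iff)
    also have "\<dots> = - 8 * n" using \<open>k \<noteq> 0\<close> k by simp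
    finally show ?thesis using True by simp
  qed (auto intro!: sum.neutral)
  have "(\<Sum>x\<in>{-n..n}. (n - 5 * x\<^sup>2) * (of_bool (x\<^sup>2 = n) + 8 * weighted_divisor_sum (n - x\<^sup>2)))
      = (\<Sum>x\<in>{-n..n}. (n - 5 * x\<^sup>2) * of_bool (x\<^sup>2 = n))
        + 8 * (\<Sum>x\<in>{-n..n}. (n - 5 * x\<^sup>2) * weighted_divisor_sum (n - x\<^sup>2))"
    by (simp only: sum_distrib_left sum.distrib[symmetric]) (simp add: algebra_simps)
  then show ?thesis using 1 2 by auto
qed

text \<open>For positive m, the term x = 0 of the recurrence has the nonzero coefficient m and every
  other term has an argument below m, so strong induction applies to the common recurrence.\<close>

lemma card_four_squares_weighted:
  "int (card (four_squares m)) = of_bool (m = 0) + 8 * weighted_divisor_sum m"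
proof (induction "nat m" arbitrary: m rule: less_induct)
  case less
  let ?r = "\<lambda>m. int (card (four_squares m))"
  let ?s = "\<lambda>m. of_bool (m = 0) + 8 * weighted_divisor_sum m"
  consider "m < 0" | "m = 0" | "m > 0" by linarith
  then show ?case
  proof cases
    case 3
    have split: "(\<Sum>x\<in>{-m..m}. (m - 5 * x\<^sup>2) * f (m - x\<^sup>2))
        = m * f m + (\<Sum>x\<in>{-m..m} - {0}. (m - 5 * x\<^sup>2) * f (m - x\<^sup>2))" for f :: "int \<Rightarrow> int"
      using 3 by (subst sum.remove[of _ 0]) auto
    have "?r (m - x\<^sup>2) = ?s (m - x\<^sup>2)" if "x \<in> {-m..m} - {0}" for x
      using less[of "m - x\<^sup>2"] 3 that by simp
    then have "(\<Sum>x\<in>{-m..m} - {0}. (m - 5 * x\<^sup>2) * ?r (m - x\<^sup>2))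
        = (\<Sum>x\<in>{-m..m} - {0}. (m - 5 * x\<^sup>2) * ?s (m - x\<^sup>2))"
      by (intro sum.cong) auto
    moreover have "(\<Sum>x\<in>{-m..m}. (m - 5 * x\<^sup>2) * ?s (m - x\<^sup>2)) = 0"
      using weighted_divisor_sum_recurrence[OF 3] by (simp add: eq_commute[of m])
    ultimately have "m * ?r m = m * ?s m"
      using four_squares_recurrence[of m] split[of ?r] split[of ?s] by linarith
    then show ?thesis using 3 by simp
  qed (auto simp: four_squares_neg four_squares_0 weighted_divisor_sum_def divisor_pairs_nonpos)
qed

section \<open>From divisor pairs to \<open>sigma\<close> at rational arguments\<close>

lemma sigma_eq_sum_divisor_pairs:
  "sigma (of_nat n) = (\<Sum>(d, e)\<in>divisor_pairs (int n). d)"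
proof (cases "n = 0")
  case False
  have "(\<Sum>d | d dvd n. int d) = (\<Sum>(d, e)\<in>divisor_pairs (int n). d)"
  proof (rule sum.reindex_bij_witness[where i = "\<lambda>(d, e). nat d" and j = "\<lambda>d. (int d, int (n div d))"])
    fix d assume "d \<in> {d. d dvd n}"
    then have "d > 0" "n div d > 0" "d * (n div d) = n" using False by (auto intro: Nat.gr0I)
    then show "(int d, int (n div d)) \<in> divisor_pairs (int n)"
      by (simp add: divisor_pairs_def flip: of_nat_mult del: of_nat_div)
  next
    fix p assume "p \<in> divisor_pairs (int n)"
    then obtain d e where p: "p = (d, e)" "d > 0" "e > 0" "d * e = int n"
      by (auto simp: divisor_pairs_def)
    have "n = nat d * nat e" using p by (metis nat_int nat_mult_distrib less_imp_le)
    then show "(case p of (d, e) \<Rightarrow> nat d) \<in> {d. d dvd n}"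
      "(int (case p of (d, e) \<Rightarrow> nat d), int (n div (case p of (d, e) \<Rightarrow> nat d))) = p"
      using p by auto
  qed auto
  then show ?thesis using False by (simp add: sigma_of_nat)
qed (simp add: sigma_def divisor_pairs_nonpos)

lemma sigma_divide_nonzeroD:
  assumes "sigma (of_nat k / of_nat p) \<noteq> 0" "p > 0"
  obtains l where "l > 0" "k = p * l"
proof -
  obtain l :: nat where l: "l > 0" "rat_of_nat k / of_nat p = of_nat l"
    using assms(1) sigma_eq_0 by blast
  then have "rat_of_nat k = of_nat (p * l)" using assms(2) by (simp add: field_simps)
  then have "k = p * l" by (simp only: of_nat_eq_iff)
  with l that show ?thesis by blast
qed

lemma sigma_divide_eq_0:
  assumes "\<not> p dvd k" "p > 0"
  shows "sigma (of_nat k / of_nat p) = 0"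
  using assms sigma_divide_nonzeroD[of k p] by (metis dvd_triv_left)

text \<open>The weight is 1 minus twice the indicator of "both even". The pairs with both entries
  even are the doubled pairs of n/4, so their d sum to 2 sigma(n/4).\<close>

lemma weighted_divisor_sum_sigma:
  "weighted_divisor_sum (int n) = sigma (of_nat n) - 4 * sigma (of_nat n / 4)"
proof -
  let ?E = "{(d, e) \<in> divisor_pairs (int n). even d \<and> even e}"
  have E: "(\<Sum>(d, e)\<in>?E. d) = 2 * sigma (of_nat n / 4)"
  proof (cases "4 dvd n")
    case True
    then obtain m where m: "n = 4 * m" by blast
    have "(\<Sum>(d, e)\<in>?E. d) = (\<Sum>(d, e)\<in>divisor_pairs (int m). 2 * d)"
      by (rule sum.reindex_bij_witness[where i = "\<lambda>(d, e). (2 * d, 2 * e)" and j = "\<lambda>(d, e). (d div 2, e div 2)"])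
        (auto simp: divisor_pairs_def m elim!: evenE)
    also have "\<dots> = 2 * sigma (of_nat m)"
      by (simp add: sigma_eq_sum_divisor_pairs sum_distrib_left case_prod_unfold)
    finally show ?thesis by (simp add: m)
  next
    case False
    then have "sigma (of_nat n / 4) = 0" using sigma_divide_eq_0[of 4 n] by simp
    moreover have E: "?E = {}"
    proof -
      have "4 dvd n" if "d * e = int n" "even d" "even e" for d e
      proof -
        have "2 * 2 dvd d * e" using that by (intro mult_dvd_mono) auto
        then show ?thesis using that by (metis numeral_times_numeral int_dvd_int_iff of_nat_numeral semiring_norm(12,13))
      qed
      then show ?thesis using False by (auto simp: divisor_pairs_def)
    qed
    ultimately show ?thesis unfolding E by simp
  qed
  have "weighted_divisor_sum (int n)
      = (\<Sum>(d, e)\<in>divisor_pairs (int n). d - 2 * (if even d \<and> even e then d else 0))"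
    unfolding weighted_divisor_sum_def by (rule sum.cong) (auto simp: parity_weight_def)
  also have "\<dots> = sigma (of_nat n) - 2 * (\<Sum>(d, e)\<in>divisor_pairs (int n). if even d \<and> even e then d else 0)"
    by (simp add: sigma_eq_sum_divisor_pairs sum_subtractf sum_distrib_left case_prod_unfold)
  also have "(\<Sum>(d, e)\<in>divisor_pairs (int n). if even d \<and> even e then d else 0) = (\<Sum>(d, e)\<in>?E. d)"
    by (rule sum.mono_neutral_cong_right) (auto simp: finite_divisor_pairs split: if_splits)
  finally show ?thesis using E by simp
qed

text \<open>The \<open>of_bool\<close> term supplies the one representation of 0, where both
  \<open>sigma\<close> values are 0; the convolution below includes zero parts.\<close>

theorem jacobi_four_squares:
  "int (card (four_squares (int n))) = of_bool (n = 0) + (8 * sigma (of_nat n) - 32 * sigma (of_nat n / 4))"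
  by (simp add: card_four_squares_weighted weighted_divisor_sum_sigma)

subsection \<open>Convolution\<close>

definition split7 :: "nat \<Rightarrow> (nat \<times> nat) set" where
  "split7 n = {(k, l). k + 7 * l = n}"

lemma finite_split7: "finite (split7 n)"
  by (rule finite_subset[of _ "{..n} \<times> {..n}"]) (auto simp: split7_def)

text \<open>Octuples are grouped by the values of their two four-square sums; these are nonnegative,
  so \<open>nat\<close> loses nothing.\<close>

lemma R7_eq_sum:
  "R7 n = (\<Sum>(k, l)\<in>split7 n. card (four_squares (int k)) * card (four_squares (int l)))"
proof -
  let ?T = "{(x1, x2, x3, x4, x5, x6, x7, x8).
     int n = x1\<^sup>2 + x2\<^sup>2 + x3\<^sup>2 + x4\<^sup>2 + 7 * (x5\<^sup>2 + x6\<^sup>2 + x7\<^sup>2 + x8\<^sup>2)}"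
  let ?Q = "SIGMA p:split7 n. four_squares (int (fst p)) \<times> four_squares (int (snd p))"
  have nat_sum: "nat s + 7 * nat t = n" if "int n = s + 7 * t" "s \<ge> 0" "t \<ge> 0" for s t
    using that by linarith
  have "card ?T = card ?Q"
  proof (rule bij_betw_same_card)
    show "bij_betw (\<lambda>(x1, x2, x3, x4, x5, x6, x7, x8).
        ((nat (x1\<^sup>2 + x2\<^sup>2 + x3\<^sup>2 + x4\<^sup>2), nat (x5\<^sup>2 + x6\<^sup>2 + x7\<^sup>2 + x8\<^sup>2)),
          (x1, x2, x3, x4), (x5, x6, x7, x8))) ?T ?Q"
      by (rule bij_betw_byWitness[where f' = "\<lambda>(p, (x1, x2, x3, x4), (x5, x6, x7, x8)).
            (x1, x2, x3, x4, x5, x6, x7, x8)"])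
        (auto simp: split7_def four_squares_def simp del: distrib_left_numeral intro!: nat_sum)
  qed
  also have "\<dots> = (\<Sum>p\<in>split7 n. card (four_squares (int (fst p)) \<times> four_squares (int (snd p))))"
    by (rule card_SigmaI) (auto simp: finite_split7 finite_four_squares)
  finally show ?thesis by (simp add: R7_def card_cartesian_product case_prod_unfold)
qed

text \<open>A summand is nonzero only for k = p*a and l = q*b with a, b positive, and then k + 7*l =
  n is the equation p*a + 7*q*b = n that indexes \<open>W\<close>.\<close>

lemma sum_split7_sigma:
  assumes "p > 0" "q > 0"
  shows "(\<Sum>(k, l)\<in>split7 n. sigma (of_nat k / of_nat p) * sigma (of_nat l / of_nat q)) = W p (7 * q) (of_nat n)"
proof -
  let ?I = "{(l, m). l > 0 \<and> m > 0 \<and> p * l + 7 * q * m = n}"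
  let ?h = "\<lambda>(l, m). (p * l, q * m)"
  have "W p (7 * q) (of_nat n) = (\<Sum>(l, m)\<in>?I. sigma (of_nat l) * sigma (of_nat m))"
    unfolding W_def of_nat_eq_iff by simp
  also have "\<dots> = (\<Sum>(k, l)\<in>?h ` ?I. sigma (of_nat k / of_nat p) * sigma (of_nat l / of_nat q))"
    using assms by (subst sum.reindex) (auto simp: inj_on_def intro!: sum.cong)
  also have "\<dots> = (\<Sum>(k, l)\<in>split7 n. sigma (of_nat k / of_nat p) * sigma (of_nat l / of_nat q))"
  proof (rule sum.mono_neutral_left)
    show "\<forall>i\<in>split7 n - ?h ` ?I. (case i of (k, l) \<Rightarrow> sigma (of_nat k / of_nat p) * sigma (of_nat l / of_nat q)) = 0"
    proof (rule ballI, rule ccontr)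
      fix i assume i: "i \<in> split7 n - ?h ` ?I"
        and nz: "(case i of (k, l) \<Rightarrow> sigma (of_nat k / of_nat p) * sigma (of_nat l / of_nat q)) \<noteq> 0"
      obtain k l where kl: "i = (k, l)" by force
      with nz obtain a b where "a > 0" "k = p * a" "b > 0" "l = q * b"
        using assms by (auto elim!: sigma_divide_nonzeroD)
      then have "i \<in> ?h ` ?I" using i kl by (auto simp: split7_def intro!: image_eqI[of _ _ "(a, b)"])
      then show False using i by blast
    qed
  qed (simp add: finite_split7, auto simp: split7_def)
  finally show ?thesis ..
qed

text \<open>Both index sets coincide, whether or not x/c is an integer. This turns
  \<open>W 4 28\<close> at n into \<open>W 1 7\<close> at n/4.\<close>

lemma W_scale:
  assumes "c > 0"
  shows "W (c * a) (c * b) x = W a b (x / of_nat c)"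
proof -
  have "of_nat (c * a * l + c * b * m) = x \<longleftrightarrow> of_nat (a * l + b * m) = x / of_nat c" for l m
    using assms by (auto simp: field_simps)
  then show ?thesis by (simp only: W_def)
qed

theorem theorem3p2:
  fixes n :: nat
  assumes "n > 0"
  shows "int (R7 n) =
    8 * sigma (of_nat n) - 32 * sigma (of_nat n / 4)
    + 8 * sigma (of_nat n / 7) - 32 * sigma (of_nat n / 28)
    + 64 * W 1 7 (of_nat n) + 1024 * W 1 7 (of_nat n / 4)
    - 256 * (W 4 7 (of_nat n) + W 1 28 (of_nat n))"
proof -
  \<comment> \<open>By Jacobi's theorem the number of four-square representations of k is
    \<open>of_bool (k = 0) + f (of_nat k)\<close>; the product of two such expressions has four
    parts, treated in turn.\<close>
  define f where "f x = 8 * sigma x - 32 * sigma (x / 4)" for x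
  have f0: "f 0 = 0" by (simp add: f_def sigma_def)
  have f_left: "(\<Sum>(k, l)\<in>split7 n. of_bool (l = 0) * f (of_nat k)) = f (of_nat n)"
  proof -
    have "(\<Sum>(k, l)\<in>split7 n. of_bool (l = 0) * f (of_nat k)) = (\<Sum>(k, l)\<in>{(n, 0 :: nat)}. f (of_nat k))"
      using finite_split7[of n] by (intro sum.mono_neutral_cong_right) (auto simp: split7_def)
    then show ?thesis by simp
  qed
  have f_right: "(\<Sum>(k, l)\<in>split7 n. of_bool (k = 0) * f (of_nat l)) = f (of_nat n / 7)"
  proof (cases "7 dvd n")
    case True
    then obtain m where m: "n = 7 * m" by blast
    have "(\<Sum>(k, l)\<in>split7 n. of_bool (k = 0) * f (of_nat l)) = (\<Sum>(k, l)\<in>{(0 :: nat, m)}. f (of_nat l))"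
      using finite_split7[of n] by (intro sum.mono_neutral_cong_right) (auto simp: split7_def m)
    then show ?thesis by (simp add: m)
  next
    case False
    \<comment> \<open>\<open>f\<close> at n/7 involves \<open>sigma\<close> at n/7 and at n/28; both
      vanish by the default value, matching the absence of a pair with k = 0.\<close>
    then have "\<not> 28 dvd n" by (auto simp: dvd_def)
    then have "sigma (of_nat n / of_nat 7) = 0" "sigma (of_nat n / of_nat 28) = 0"
      using False by (auto intro: sigma_divide_eq_0 simp del: of_nat_numeral)
    then have "f (of_nat n / 7) = 0" by (simp add: f_def)
    moreover have "(\<Sum>(k, l)\<in>split7 n. of_bool (k = 0) * f (of_nat l)) = 0"
      using False by (intro sum.neutral) (auto simp: split7_def intro: Nat.gr0I)
    ultimately show ?thesis by simp
  qed
  \<comment> \<open>The pair (0, 0) would need n = 0.\<close>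
  have ones: "(\<Sum>(k, l)\<in>split7 n. of_bool (k = 0) * of_bool (l = 0)) = (0 :: int)"
    using assms by (intro sum.neutral) (auto simp: split7_def)
  have conv: "(\<Sum>(k, l)\<in>split7 n. f (of_nat k) * f (of_nat l))
    = 64 * W 1 7 (of_nat n) - 256 * W 1 28 (of_nat n) - 256 * W 4 7 (of_nat n) + 1024 * W 4 28 (of_nat n)"
  proof -
    \<comment> \<open>The explicit denominators \<open>of_nat 1\<close> and \<open>of_nat 4\<close>
      put all four products into the form of \<open>sum_split7_sigma\<close>.\<close>
    have "(\<Sum>(k, l)\<in>split7 n. f (of_nat k) * f (of_nat l)) =
      (\<Sum>(k, l)\<in>split7 n. 64 * (sigma (of_nat k / of_nat 1) * sigma (of_nat l / of_nat 1))
        - 256 * (sigma (of_nat k / of_nat 1) * sigma (of_nat l / of_nat 4))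
        - 256 * (sigma (of_nat k / of_nat 4) * sigma (of_nat l / of_nat 1))
        + 1024 * (sigma (of_nat k / of_nat 4) * sigma (of_nat l / of_nat 4)))"
      by (rule sum.cong) (auto simp: f_def algebra_simps)
    also have "\<dots> = 64 * W 1 (7 * 1) (of_nat n) - 256 * W 1 (7 * 4) (of_nat n)
        - 256 * W 4 (7 * 1) (of_nat n) + 1024 * W 4 (7 * 4) (of_nat n)"
      by (simp only: sum_split7_sigma[symmetric] zero_less_one zero_less_numeral
          sum.distrib sum_subtractf sum_distrib_left case_prod_unfold)
    finally show ?thesis by simp
  qed
  have "int (R7 n) = (\<Sum>(k, l)\<in>split7 n. (of_bool (k = 0) + f (of_nat k)) * (of_bool (l = 0) + f (of_nat l)))"
    by (simp add: R7_eq_sum case_prod_unfold jacobi_four_squares f_def)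
  also have "\<dots> = (\<Sum>(k, l)\<in>split7 n. of_bool (k = 0) * of_bool (l = 0) + of_bool (l = 0) * f (of_nat k)
      + of_bool (k = 0) * f (of_nat l) + f (of_nat k) * f (of_nat l))"
    by (rule sum.cong) (auto simp: algebra_simps)
  also have "\<dots> = f (of_nat n) + f (of_nat n / 7) + (\<Sum>(k, l)\<in>split7 n. f (of_nat k) * f (of_nat l))"
    using ones f_left f_right by (simp add: sum.distrib case_prod_unfold)
  finally show ?thesis
    using conv W_scale[of 4 1 7 "of_nat n"] by (simp add: f_def)
qed

end
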